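(* Let $P$ be a non-degenerate probability distribution on $[0,1]$ with mean $m$, and let $X_1,X_2,\dots$ be i.i.d. with law $P$. Let $\pi$ be a probability measure on $[-\frac1{1-m},\frac1m]$. Then the mixture wealth $$W_n^\pi=\int\Bigl\{\prod_{k=1}^n\bigl(1+\lambda(X_k-m)\bigr)\Bigr\}\,\pi(\mathrm d\lambda)$$ converges to $\pi(\{0\})$ almost surely as $n\to\infty$. In particular, $\lim_{n}W_n^\pi=0$ almost surely if and only if $\pi$ does not have an atom at $0$, i.e. $\pi(\{0\})=0$.
   Context: "Non-degenerate" means that $P$ is not a point mass (so $0<m<1$). *)

theory Defs
  imports "HOL-Probability.Probability"
begin

text \<open>
  For fixed \<open>\<omega>\<close> the integrand is a polynomial in \<open>l\<close>, so the Bochner integral exists whenever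
  \<open>\<pi>\<close> is a finite Borel measure concentrated on a bounded interval; the convention
  that non-integrable functions have integral \<open>0\<close> is then never used.
\<close>

definition mixture_wealth ::
  "real measure \<Rightarrow> real \<Rightarrow> (nat \<Rightarrow> 'a \<Rightarrow> real) \<Rightarrow> nat \<Rightarrow> 'a \<Rightarrow> real" where
  "mixture_wealth \<pi> m X n \<omega> = (\<integral>l. (\<Prod>k=1..n. 1 + l * (X k \<omega> - m)) \<partial>\<pi>)"

text \<open>A distribution on an interval is a Borel probability measure on the whole real line that
  gives that interval full mass.\<close>

definition distribution_on :: "real set \<Rightarrow> real measure \<Rightarrow> bool" where
  "distribution_on I \<mu> \<longleftrightarrow> real_distribution \<mu> \<and> measure \<mu> I = 1"

definition point_mass :: "real measure \<Rightarrow> bool" where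
  "point_mass \<mu> \<longleftrightarrow> (\<exists>c. \<mu> = return borel c)"

end

theory Submission
  imports Defs
begin

text \<open>
  Split the mixture over the stakes \<open>l = 0\<close>, \<open>0 < \<bar>l\<bar> < \<eta>\<close> and \<open>\<bar>l\<bar> \<ge> \<eta>\<close>. The first part contributes
  exactly \<open>\<pi> {0}\<close>. The second is a nonnegative martingale with initial value
  \<open>\<pi> {l. 0 < \<bar>l\<bar> < \<eta>}\<close>, so by Ville's inequality it stays uniformly small with probability
  close to 1 when \<open>\<eta>\<close> is small; a dominated convergence argument is not available here, since the
  supremum over \<open>l\<close> of the wealth is unbounded. For the third, Bernoulli's inequality bounds the wealth
  of a stake \<open>s * \<eta>\<close> with \<open>s \<ge> 1\<close> by that of \<open>\<eta>\<close> as soon as the latter is at most 1, and likewise for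
  \<open>- \<eta>\<close>. For \<open>\<eta> \<le> 1\<close> both \<open>\<eta>\<close> and \<open>- \<eta>\<close> are admissible stakes, and their wealth tends to 0 almost surely.
\<close>

lemma one_plus_mult_le_powr:
  fixes z s :: real
  assumes "1 \<le> s" "-1 < z" "0 \<le> 1 + s * z"
  shows "1 + s * z \<le> (1 + z) powr s"
proof (cases "1 + s * z = 0")
  case False
  have "(1 + s * z) powr (1 / s) * 1 powr (1 - 1 / s) \<le> (1 / s) * (1 + s * z) + (1 - 1 / s) * 1"
    using assms False by (intro Youngs_inequality_0) auto
  also have "\<dots> = 1 + z"
    using assms by (simp add: field_simps)
  finally have "((1 + s * z) powr (1 / s)) powr s \<le> (1 + z) powr s"
    using assms by (intro powr_mono2) auto
  then show ?thesis
    using assms False by (simp add: powr_powr)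
qed simp

lemma prod_scaled_le:
  fixes z :: "'i \<Rightarrow> real"
  assumes "1 \<le> s" and z: "\<And>k. k \<in> A \<Longrightarrow> -1 < z k" "\<And>k. k \<in> A \<Longrightarrow> 0 \<le> 1 + s * z k"
    and le1: "(\<Prod>k\<in>A. 1 + z k) \<le> 1"
  shows "(\<Prod>k\<in>A. 1 + s * z k) \<le> (\<Prod>k\<in>A. 1 + z k)"
proof -
  have nn: "0 \<le> (\<Prod>k\<in>A. 1 + z k)"
    using z(1) by (intro prod_nonneg) (force dest: z(1))
  have "(\<Prod>k\<in>A. 1 + s * z k) \<le> (\<Prod>k\<in>A. (1 + z k) powr s)"
    using assms by (intro prod_mono conjI one_plus_mult_le_powr) auto
  also have "\<dots> = (\<Prod>k\<in>A. 1 + z k) powr s"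
    by (rule prod_powr_distrib[symmetric])
  also have "\<dots> \<le> (\<Prod>k\<in>A. 1 + z k) powr 1"
    using powr_mono'[of 1 s "\<Prod>k\<in>A. 1 + z k"] nn le1 assms(1) by simp
  also have "\<dots> = (\<Prod>k\<in>A. 1 + z k)"
    using nn by simp
  finally show ?thesis .
qed

lemma (in prob_space) indep_var_nn_integral_mult:
  fixes F G :: "'a \<Rightarrow> ennreal"
  assumes "indep_var borel F borel G"
  shows "(\<integral>\<^sup>+\<omega>. F \<omega> * G \<omega> \<partial>M) = (\<integral>\<^sup>+\<omega>. F \<omega> \<partial>M) * (\<integral>\<^sup>+\<omega>. G \<omega> \<partial>M)"
proof -
  have "indep_vars (\<lambda>_. borel) (case_bool F G) UNIV"
    using assms unfolding indep_var_def
    by (rule indep_vars_cong[THEN iffD1, rotated -1]) (auto split: bool.split)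
  from indep_vars_nn_integral[OF _ this] show ?thesis
    by (simp add: UNIV_bool mult.commute)
qed

lemma (in prob_space) nn_integral_past_times_next:
  fixes X :: "nat \<Rightarrow> 'a \<Rightarrow> real" and g :: "real \<Rightarrow> ennreal"
  assumes indep: "indep_vars (\<lambda>_. borel) X {1..}"
    and f: "f \<in> borel_measurable (PiM {1..n} (\<lambda>_. borel))"
    and g: "g \<in> borel_measurable borel"
  shows "(\<integral>\<^sup>+\<omega>. f (\<lambda>i\<in>{1..n}. X i \<omega>) * g (X (Suc n) \<omega>) \<partial>M) =
    (\<integral>\<^sup>+\<omega>. f (\<lambda>i\<in>{1..n}. X i \<omega>) \<partial>M) * (\<integral>\<^sup>+\<omega>. g (X (Suc n) \<omega>) \<partial>M)"
proof -
  let ?B = "{Suc n}"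
  have "indep_var (PiM {1..n} (\<lambda>_. borel)) (\<lambda>\<omega>. \<lambda>i\<in>{1..n}. X i \<omega>)
      (PiM ?B (\<lambda>_. borel)) (\<lambda>\<omega>. \<lambda>i\<in>?B. X i \<omega>)"
    using indep by (intro indep_var_restrict) auto
  moreover have "(\<lambda>x. g (x (Suc n))) \<in> borel_measurable (PiM ?B (\<lambda>_. borel))"
    using g by measurable
  ultimately have "indep_var borel (f \<circ> (\<lambda>\<omega>. \<lambda>i\<in>{1..n}. X i \<omega>))
      borel ((\<lambda>x. g (x (Suc n))) \<circ> (\<lambda>\<omega>. \<lambda>i\<in>?B. X i \<omega>))"
    using f by (intro indep_var_compose)
  from indep_var_nn_integral_mult[OF this] show ?thesis
    by (simp add: comp_def)
qed

definition mixture_product :: "'b measure \<Rightarrow> ('b \<Rightarrow> real \<Rightarrow> ennreal) \<Rightarrow> nat \<Rightarrow> (nat \<Rightarrow> real) \<Rightarrow> ennreal" where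
  "mixture_product N u n x = (\<integral>\<^sup>+l. (\<Prod>k=1..n. u l (x k)) \<partial>N)"

lemma mixture_product_restrict:
  "i \<le> n \<Longrightarrow> mixture_product N u i (restrict x {1..n}) = mixture_product N u i x"
  unfolding mixture_product_def by (intro nn_integral_cong prod.cong) auto

locale mixture_martingale = prob_space M + N: finite_measure N
  for M :: "'a measure" and N :: "'b measure" +
  fixes u :: "'b \<Rightarrow> real \<Rightarrow> ennreal" and X :: "nat \<Rightarrow> 'a \<Rightarrow> real"
  assumes measurable_u: "(\<lambda>p. u (fst p) (snd p)) \<in> borel_measurable (N \<Otimes>\<^sub>M borel)"
    and indep: "indep_vars (\<lambda>_. borel) X {1..}"
    and mean_one: "\<And>n. AE l in N. (\<integral>\<^sup>+\<omega>. u l (X (Suc n) \<omega>) \<partial>M) = 1"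
begin

abbreviation W :: "nat \<Rightarrow> 'a \<Rightarrow> ennreal" where
  "W n \<omega> \<equiv> mixture_product N u n (\<lambda>k. X k \<omega>)"

lemma measurable_u_compose [measurable (raw)]:
  assumes "f \<in> measurable K N" "g \<in> borel_measurable K"
  shows "(\<lambda>x. u (f x) (g x)) \<in> borel_measurable K"
  using measurable_compose[OF measurable_Pair[OF assms] measurable_u] by simp

lemma measurable_X [measurable]: "1 \<le> k \<Longrightarrow> X k \<in> borel_measurable M"
  using indep by (auto simp: indep_vars_def)

lemma measurable_mixture_product [measurable]:
  assumes "i \<le> n"
  shows "mixture_product N u i \<in> borel_measurable (PiM {1..n} (\<lambda>_. borel))"
  unfolding mixture_product_def
proof (intro N.borel_measurable_nn_integral)
  have "(\<lambda>p. u (snd p) (fst p k)) \<in> borel_measurable (PiM {1..n} (\<lambda>_. borel) \<Otimes>\<^sub>M N)" if "k \<in> {1..i}" for k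
  proof -
    have "k \<in> {1..n}"
      using that assms by simp
    then show ?thesis
      by measurable
  qed
  then have "(\<lambda>p. \<Prod>k=1..i. u (snd p) (fst p k)) \<in> borel_measurable (PiM {1..n} (\<lambda>_. borel) \<Otimes>\<^sub>M N)"
    by (rule borel_measurable_prod_ennreal)
  then show "(\<lambda>(x, l). \<Prod>k=1..i. u l (x k)) \<in> borel_measurable (PiM {1..n} (\<lambda>_. borel) \<Otimes>\<^sub>M N)"
    by (simp add: case_prod_beta)
qed

lemma measurable_past [measurable]: "(\<lambda>\<omega>. \<lambda>i\<in>{1..n}. X i \<omega>) \<in> measurable M (PiM {1..n} (\<lambda>_. borel))"
  by (rule measurable_restrict) simp

lemma measurable_W [measurable]: "W n \<in> borel_measurable M"
  using measurable_compose[OF measurable_past measurable_mixture_product[of n n]]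
  by (simp add: mixture_product_restrict del: One_nat_def)

lemma martingale_step:
  assumes h [measurable]: "h \<in> borel_measurable (PiM {1..n} (\<lambda>_. borel))"
  shows "(\<integral>\<^sup>+\<omega>. h (\<lambda>i\<in>{1..n}. X i \<omega>) * W (Suc n) \<omega> \<partial>M) = (\<integral>\<^sup>+\<omega>. h (\<lambda>i\<in>{1..n}. X i \<omega>) * W n \<omega> \<partial>M)"
proof -
  interpret MN: pair_sigma_finite M N ..
  let ?h = "\<lambda>\<omega>. h (\<lambda>i\<in>{1..n}. X i \<omega>)" and ?L = "\<lambda>n l \<omega>. \<Prod>k=1..n. u l (X k \<omega>)"
  have L [measurable]: "(\<lambda>p. ?L j (snd p) (fst p)) \<in> borel_measurable (M \<Otimes>\<^sub>M N)" for j
    by (intro borel_measurable_prod_ennreal) auto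
  have L1 [measurable]: "(\<lambda>l. ?L j l \<omega>) \<in> borel_measurable N" for j \<omega>
    by (intro borel_measurable_prod_ennreal) auto
  have L2 [measurable]: "?L j l \<in> borel_measurable M" if "l \<in> space N" for j l
    using that by (intro borel_measurable_prod_ennreal) auto
  have swap: "(\<integral>\<^sup>+\<omega>. ?h \<omega> * W j \<omega> \<partial>M) = (\<integral>\<^sup>+l. (\<integral>\<^sup>+\<omega>. ?h \<omega> * ?L j l \<omega> \<partial>M) \<partial>N)" for j
  proof -
    have "(\<integral>\<^sup>+\<omega>. ?h \<omega> * W j \<omega> \<partial>M) = (\<integral>\<^sup>+\<omega>. (\<integral>\<^sup>+l. ?h \<omega> * ?L j l \<omega> \<partial>N) \<partial>M)"
      unfolding mixture_product_def by (intro nn_integral_cong nn_integral_cmult[symmetric]) auto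
    also have "\<dots> = (\<integral>\<^sup>+l. (\<integral>\<^sup>+\<omega>. ?h \<omega> * ?L j l \<omega> \<partial>M) \<partial>N)"
    proof (rule MN.Fubini'[symmetric])
      have "?h \<in> borel_measurable M"
        by (rule measurable_compose[OF measurable_past h])
      then have "(\<lambda>p. ?h (fst p) * ?L j (snd p) (fst p)) \<in> borel_measurable (M \<Otimes>\<^sub>M N)"
        by (intro borel_measurable_times_ennreal L measurable_compose[OF measurable_fst])
      then show "(\<lambda>(\<omega>, l). ?h \<omega> * ?L j l \<omega>) \<in> borel_measurable (M \<Otimes>\<^sub>M N)"
        by (simp add: case_prod_beta)
    qed
    finally show ?thesis .
  qed
  have "AE l in N. (\<integral>\<^sup>+\<omega>. ?h \<omega> * ?L (Suc n) l \<omega> \<partial>M) = (\<integral>\<^sup>+\<omega>. ?h \<omega> * ?L n l \<omega> \<partial>M)"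
    using mean_one[of n] AE_space
  proof eventually_elim
    case (elim l)
    let ?f = "\<lambda>x. h x * (\<Prod>k=1..n. u l (x k))"
    have "(\<lambda>x. u l (x k)) \<in> borel_measurable (PiM {1..n} (\<lambda>_. borel))" if "k \<in> {1..n}" for k
      using elim that by measurable
    then have f: "?f \<in> borel_measurable (PiM {1..n} (\<lambda>_. borel))"
      by (intro borel_measurable_times_ennreal h borel_measurable_prod_ennreal)
    have g: "u l \<in> borel_measurable borel"
      using elim by measurable
    have f_eq: "?f (\<lambda>i\<in>{1..n}. X i \<omega>) = ?h \<omega> * ?L n l \<omega>" for \<omega>
      by simp
    show ?case
      using nn_integral_past_times_next[OF indep f g] elim unfolding f_eq
      by (simp add: mult.assoc)
  qed
  then show ?thesis
    unfolding swap by (rule nn_integral_cong_AE)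
qed

text \<open>The integrand \<open>S n\<close> below is the martingale, replaced by \<open>\<epsilon>\<close> once it has exceeded \<open>\<epsilon>\<close>: this is
  Ville's stopping argument without stopping times.\<close>

lemma ville_inequality:
  "\<epsilon> * emeasure M {\<omega>\<in>space M. \<exists>n. \<epsilon> < W n \<omega>} \<le> emeasure N (space N)"
proof -
  define Q where "Q n x \<longleftrightarrow> (\<forall>i\<le>n. mixture_product N u i x \<le> \<epsilon>)" for n x
  define S where "S n \<omega> = (if Q n (\<lambda>k. X k \<omega>) then W n \<omega> else \<epsilon>)" for n \<omega>
  have Q_restrict: "Q n (restrict x {1..n}) = Q n x" for n x
    by (simp add: Q_def mixture_product_restrict del: One_nat_def)
  have Q_PiM: "Measurable.pred (PiM {1..n} (\<lambda>_. borel)) (Q n)" for n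
  proof -
    have "Measurable.pred (PiM {1..n} (\<lambda>_. borel)) (\<lambda>x. mixture_product N u i x \<le> \<epsilon>)" if "i \<in> {..n}" for i
    proof -
      have [measurable]: "mixture_product N u i \<in> borel_measurable (PiM {1..n} (\<lambda>_. borel))"
        using that by (intro measurable_mixture_product) simp
      show ?thesis
        by measurable
    qed
    then have "Measurable.pred (PiM {1..n} (\<lambda>_. borel)) (\<lambda>x. \<forall>i\<in>{..n}. mixture_product N u i x \<le> \<epsilon>)"
      by (rule pred_intros_finite(3)[OF finite_atMost])
    moreover have "Q n = (\<lambda>x. \<forall>i\<in>{..n}. mixture_product N u i x \<le> \<epsilon>)"
      by (simp add: Q_def fun_eq_iff Ball_def)
    ultimately show ?thesis
      by (simp only:)
  qed
  have Q_meas [measurable]: "Measurable.pred M (\<lambda>\<omega>. Q n (\<lambda>k. X k \<omega>))" for n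
    using measurable_compose[OF measurable_past Q_PiM[of n]] by (simp only: Q_restrict)
  have S_meas [measurable]: "S n \<in> borel_measurable M" for n
    unfolding S_def by (intro measurable_If borel_measurable_const measurable_W Q_meas[unfolded pred_def])
  have S_bound: "(\<integral>\<^sup>+\<omega>. S n \<omega> \<partial>M) \<le> emeasure N (space N)" for n
  proof (induction n)
    case 0
    have "S 0 \<omega> \<le> emeasure N (space N)" for \<omega>
      by (auto simp: S_def Q_def mixture_product_def)
    then have "(\<integral>\<^sup>+\<omega>. S 0 \<omega> \<partial>M) \<le> (\<integral>\<^sup>+\<omega>. emeasure N (space N) \<partial>M)"
      by (intro nn_integral_mono)
    then show ?case
      by (simp add: emeasure_space_1)
  next
    case (Suc n)
    let ?h = "\<lambda>x. if Q n x then 1 else 0 :: ennreal"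
    have h: "?h \<in> borel_measurable (PiM {1..n} (\<lambda>_. borel))"
      by (intro measurable_If borel_measurable_const Q_PiM[unfolded pred_def])
    have step: "(\<integral>\<^sup>+\<omega>. ?h (\<lambda>k. X k \<omega>) * W (Suc n) \<omega> \<partial>M) = (\<integral>\<^sup>+\<omega>. ?h (\<lambda>k. X k \<omega>) * W n \<omega> \<partial>M)"
      using martingale_step[OF h] by (simp add: Q_restrict del: One_nat_def)
    let ?e = "\<lambda>\<omega>. if Q n (\<lambda>k. X k \<omega>) then 0 else \<epsilon>"
    have meas: "(\<lambda>\<omega>. ?h (\<lambda>k. X k \<omega>)) \<in> borel_measurable M" "?e \<in> borel_measurable M"
      by (intro measurable_If borel_measurable_const Q_meas[unfolded pred_def])+
    have "(\<integral>\<^sup>+\<omega>. S (Suc n) \<omega> \<partial>M) \<le> (\<integral>\<^sup>+\<omega>. ?h (\<lambda>k. X k \<omega>) * W (Suc n) \<omega> + ?e \<omega> \<partial>M)"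
      by (intro nn_integral_mono) (auto simp: S_def Q_def le_Suc_eq not_le intro: less_imp_le)
    also have "\<dots> = (\<integral>\<^sup>+\<omega>. ?h (\<lambda>k. X k \<omega>) * W (Suc n) \<omega> \<partial>M) + (\<integral>\<^sup>+\<omega>. ?e \<omega> \<partial>M)"
      by (intro nn_integral_add borel_measurable_times_ennreal meas measurable_W)
    also have "\<dots> = (\<integral>\<^sup>+\<omega>. ?h (\<lambda>k. X k \<omega>) * W n \<omega> \<partial>M) + (\<integral>\<^sup>+\<omega>. ?e \<omega> \<partial>M)"
      by (simp only: step)
    also have "\<dots> = (\<integral>\<^sup>+\<omega>. ?h (\<lambda>k. X k \<omega>) * W n \<omega> + ?e \<omega> \<partial>M)"
      by (intro nn_integral_add[symmetric] borel_measurable_times_ennreal meas measurable_W)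
    also have "\<dots> = (\<integral>\<^sup>+\<omega>. S n \<omega> \<partial>M)"
      by (intro nn_integral_cong) (simp add: S_def)
    finally show ?case
      using Suc.IH by simp
  qed
  let ?E = "\<lambda>n. {\<omega>\<in>space M. \<exists>i\<le>n. \<epsilon> < W i \<omega>}"
  have E_eq: "?E n = space M - {\<omega>\<in>space M. Q n (\<lambda>k. X k \<omega>)}" for n
    by (auto simp: Q_def not_le)
  have E_sets: "?E n \<in> sets M" for n
    using Q_meas[of n] unfolding E_eq by (simp add: pred_def)
  have E_bound: "\<epsilon> * emeasure M (?E n) \<le> emeasure N (space N)" for n
  proof -
    have "\<epsilon> * emeasure M (?E n) = (\<integral>\<^sup>+\<omega>. \<epsilon> * indicator (?E n) \<omega> \<partial>M)"
      by (intro nn_integral_cmult_indicator[symmetric] E_sets)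
    also have "\<dots> \<le> (\<integral>\<^sup>+\<omega>. S n \<omega> \<partial>M)"
      by (intro nn_integral_mono) (auto simp: S_def Q_def split: split_indicator)
    finally show ?thesis
      using S_bound[of n] by simp
  qed
  have "emeasure M (\<Union>n. ?E n) = (SUP n. emeasure M (?E n))"
    by (intro SUP_emeasure_incseq[symmetric]) (auto simp: incseq_def E_sets[simplified] intro: order_trans)
  moreover have "(\<Union>n. ?E n) = {\<omega>\<in>space M. \<exists>n. \<epsilon> < W n \<omega>}"
    by auto
  ultimately show ?thesis
    using E_bound by (auto simp: SUP_mult_left_ennreal intro: SUP_least)
qed

end

lemma (in real_distribution) eq_return_if_AE_const:
  assumes "AE x in M. x = c"
  shows "M = return borel c"
proof (rule measure_eqI)
  fix A assume A: "A \<in> sets M"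
  show "emeasure M A = emeasure (return borel c) A"
  proof (cases "c \<in> A")
    case True
    then have "AE x in M. x \<in> A"
      using assms by auto
    then show ?thesis
      using A True by (simp add: emeasure_eq_1_AE)
  next
    case False
    then have "AE x in M. x \<notin> A"
      using assms by auto
    then have "emeasure M A = 0"
      using A by (simp add: AE_iff_measurable[OF A])
    then show ?thesis
      using A False by simp
  qed
qed simp

lemma sqrt_one_plus_le:
  fixes y :: real
  assumes "-1 \<le> y"
  shows "sqrt (1 + y) \<le> 1 + y / 2" and "sqrt (1 + y) = 1 + y / 2 \<Longrightarrow> y = 0"
proof -
  have sq: "(1 + y / 2)\<^sup>2 = (1 + y) + (y / 2)\<^sup>2"
    by (simp add: power2_eq_square field_simps)
  then show "sqrt (1 + y) \<le> 1 + y / 2"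
    using assms by (intro real_le_lsqrt) auto
  show "y = 0" if "sqrt (1 + y) = 1 + y / 2"
    using sq assms real_sqrt_pow2[of "1 + y"] unfolding that by simp
qed

locale iid_wealth = prob_space M
  for M :: "'a measure" +
  fixes P \<pi> :: "real measure" and X :: "nat \<Rightarrow> 'a \<Rightarrow> real" and m :: real
  assumes P_dist: "distribution_on {0..1} P"
    and nondegenerate: "\<not> point_mass P"
    and m_eq: "m = (\<integral>x. x \<partial>P)"
    and indep_X: "indep_vars (\<lambda>_. borel) X {1..}"
    and distr_X: "\<And>k. k \<ge> 1 \<Longrightarrow> distr M borel (X k) = P"
    and \<pi>_dist: "distribution_on {- 1 / (1 - m)..1 / m} \<pi>"

sublocale iid_wealth \<subseteq> P: real_distribution P
  using P_dist by (simp add: distribution_on_def)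

sublocale iid_wealth \<subseteq> \<pi>: real_distribution \<pi>
  using \<pi>_dist by (simp add: distribution_on_def)

context iid_wealth
begin

definition bet :: "real \<Rightarrow> real \<Rightarrow> ennreal" where
  "bet l x = ennreal (1 + l * (x - m))"

definition wealth_on :: "real set \<Rightarrow> nat \<Rightarrow> 'a \<Rightarrow> ennreal" where
  "wealth_on D n \<omega> = (\<integral>\<^sup>+l. indicator D l * (\<Prod>k=1..n. bet l (X k \<omega>)) \<partial>\<pi>)"

lemma measurable_bet [measurable]: "(\<lambda>l. bet l x) \<in> borel_measurable borel" "bet l \<in> borel_measurable borel"
  unfolding bet_def by measurable

lemma measurable_X [measurable]: "1 \<le> k \<Longrightarrow> X k \<in> borel_measurable M"
  using indep_X by (auto simp: indep_vars_def)

lemma AE_P: "AE x in P. x \<in> {0..1}"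
  using P_dist by (intro P.AE_prob_1) (simp add: distribution_on_def)

lemma AE_\<pi>: "AE l in \<pi>. l \<in> {- 1 / (1 - m)..1 / m}"
  using \<pi>_dist by (intro \<pi>.AE_prob_1) (simp add: distribution_on_def)

lemma integrable_P [simp]: "integrable P (\<lambda>x. x)"
  using AE_P by (intro P.integrable_const_bound[where B = 1]) auto

lemma not_AE_const: "\<not> (AE x in P. x = c)"
  using nondegenerate P.eq_return_if_AE_const by (auto simp: point_mass_def)

lemma m_pos: "0 < m"
proof -
  have nn: "AE x in P. 0 \<le> x"
    using AE_P by auto
  then have "0 \<le> m"
    unfolding m_eq by (rule integral_nonneg_AE)
  moreover have "m \<noteq> 0"
    using integral_nonneg_eq_0_iff_AE[OF integrable_P nn] not_AE_const[of 0] m_eq by simp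
  ultimately show ?thesis
    by simp
qed

lemma m_less_one: "m < 1"
proof -
  have nn: "AE x in P. 0 \<le> 1 - x"
    using AE_P by auto
  have int: "integrable P (\<lambda>x. 1 - x)"
    by simp
  have eq: "(\<integral>x. 1 - x \<partial>P) = 1 - m"
    by (simp add: m_eq P.prob_space[simplified])
  have "0 \<le> 1 - m"
    using integral_nonneg_AE[OF nn] eq by simp
  moreover have "1 - m \<noteq> 0"
  proof
    assume "1 - m = 0"
    then have "AE x in P. 1 - x = 0"
      using integral_nonneg_eq_0_iff_AE[OF int nn] eq by simp
    then have "AE x in P. x = 1"
      by eventually_elim simp
    with not_AE_const show False by blast
  qed
  ultimately show ?thesis
    by simp
qed

lemma AE_X: "AE \<omega> in M. \<forall>k\<ge>1. X k \<omega> \<in> {0..1}"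
proof -
  have "AE \<omega> in M. X k \<omega> \<in> {0..1}" if "1 \<le> k" for k
    using AE_P that unfolding distr_X[OF that, symmetric] by (subst (asm) AE_distr_iff) auto
  then show ?thesis
    by (subst AE_all_countable) auto
qed

lemma factor_nonneg:
  assumes l: "l \<in> {- 1 / (1 - m)..1 / m}" and x: "x \<in> {0..1}"
  shows "0 \<le> 1 + l * (x - m)"
proof (cases "0 \<le> l")
  case True
  have "l * m \<le> 1"
    using l m_pos by (simp add: field_simps)
  moreover have "l * (- m) \<le> l * (x - m)"
    using True x by (intro mult_left_mono) auto
  ultimately show ?thesis
    by simp
next
  case False
  have "- 1 \<le> l * (1 - m)"
    using l m_less_one by (simp add: field_simps)
  moreover have "l * (1 - m) \<le> l * (x - m)"
    using False x by (intro mult_left_mono_neg) auto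
  ultimately show ?thesis
    by simp
qed

lemma factor_pos:
  assumes "\<bar>\<eta>\<bar> \<le> 1" and x: "x \<in> {0..1}"
  shows "-1 < \<eta> * (x - m)"
proof -
  have "\<bar>x - m\<bar> < 1"
    using x m_pos m_less_one by auto
  then have "\<bar>\<eta>\<bar> * \<bar>x - m\<bar> < 1"
    using assms(1) mult_right_mono[of "\<bar>\<eta>\<bar>" 1 "\<bar>x - m\<bar>"] by simp
  then show ?thesis
    by (simp add: abs_mult[symmetric] abs_less_iff)
qed

lemma nn_integral_bet:
  assumes "l \<in> {- 1 / (1 - m)..1 / m}" "1 \<le> k"
  shows "(\<integral>\<^sup>+\<omega>. bet l (X k \<omega>) \<partial>M) = 1"
proof -
  have "(\<integral>\<^sup>+\<omega>. bet l (X k \<omega>) \<partial>M) = (\<integral>\<^sup>+x. bet l x \<partial>P)"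
    unfolding distr_X[OF assms(2), symmetric] using assms(2) by (subst nn_integral_distr) auto
  also have "\<dots> = ennreal (\<integral>x. 1 + l * (x - m) \<partial>P)"
    unfolding bet_def
  proof (rule nn_integral_eq_integral)
    show "AE x in P. 0 \<le> 1 + l * (x - m)"
      using AE_P by eventually_elim (rule factor_nonneg[OF assms(1)])
  qed simp
  also have "(\<integral>x. 1 + l * (x - m) \<partial>P) = 1"
    by (simp add: m_eq[symmetric] P.prob_space[simplified])
  finally show ?thesis
    by simp
qed

lemma wealth_on_ville:
  assumes D: "D \<in> sets borel"
  shows "\<epsilon> * emeasure M {\<omega>\<in>space M. \<exists>n. \<epsilon> < wealth_on D n \<omega>} \<le> emeasure \<pi> D"
    and "wealth_on D n \<in> borel_measurable M"
proof -
  let ?N = "density \<pi> (indicator D)"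
  have D\<pi>: "D \<in> sets \<pi>"
    using D by simp
  have [measurable]: "(indicator D :: real \<Rightarrow> ennreal) \<in> borel_measurable \<pi>"
    using D\<pi> by simp
  have prod_meas: "(\<lambda>l. \<Prod>k=1..n. bet l (x k)) \<in> borel_measurable \<pi>" for n and x :: "nat \<Rightarrow> real"
    by (intro borel_measurable_prod_ennreal) simp
  have N_space: "emeasure ?N (space ?N) = emeasure \<pi> D"
    using D\<pi> by (simp add: emeasure_density)
  interpret N: finite_measure ?N
    by standard (simp add: N_space[simplified])
  interpret mm: mixture_martingale M ?N bet X
  proof
    show "(\<lambda>p. bet (fst p) (snd p)) \<in> borel_measurable (?N \<Otimes>\<^sub>M borel)"
      unfolding bet_def by measurable
    show "AE l in ?N. (\<integral>\<^sup>+\<omega>. bet l (X (Suc n) \<omega>) \<partial>M) = 1" for n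
    proof (subst AE_density)
      show "AE l in \<pi>. 0 < (indicator D l :: ennreal) \<longrightarrow> (\<integral>\<^sup>+\<omega>. bet l (X (Suc n) \<omega>) \<partial>M) = 1"
        using AE_\<pi> by eventually_elim (simp only: nn_integral_bet le_add2 plus_1_eq_Suc[symmetric] simp_thms)
    qed simp
  qed (rule indep_X)
  have wealth_on_eq: "wealth_on D n \<omega> = mm.W n \<omega>" for n \<omega>
    unfolding wealth_on_def mixture_product_def
    by (rule nn_integral_density[symmetric]) (simp_all add: D prod_meas)
  show "\<epsilon> * emeasure M {\<omega>\<in>space M. \<exists>n. \<epsilon> < wealth_on D n \<omega>} \<le> emeasure \<pi> D"
    using mm.ville_inequality[of \<epsilon>] unfolding wealth_on_eq N_space .
  show "wealth_on D n \<in> borel_measurable M"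
    using mm.measurable_W[of n] by (simp add: wealth_on_eq[abs_def])
qed

lemma sqrt_mean_less_one:
  assumes "\<eta> \<noteq> 0" "\<bar>\<eta>\<bar> \<le> 1"
  shows "(\<integral>x. sqrt (1 + \<eta> * (x - m)) \<partial>P) < 1"
    and "integrable P (\<lambda>x. sqrt (1 + \<eta> * (x - m)))"
proof -
  let ?g = "\<lambda>x. \<eta> * (x - m)"
  have pos: "AE x in P. -1 \<le> ?g x"
    using AE_P by eventually_elim (use factor_pos[OF assms(2)] in force)
  have g_int: "integrable P (\<lambda>x. 1 + ?g x / 2)"
    by simp
  have bound: "AE x in P. norm (sqrt (1 + ?g x)) \<le> norm (1 + ?g x / 2)"
    using pos by eventually_elim (use sqrt_one_plus_le(1) in force)
  show int: "integrable P (\<lambda>x. sqrt (1 + ?g x))"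
    by (rule Bochner_Integration.integrable_bound[OF g_int _ bound]) simp
  let ?d = "\<lambda>x. 1 + ?g x / 2 - sqrt (1 + ?g x)"
  have d_int: "integrable P ?d"
    using g_int int by (rule Bochner_Integration.integrable_diff)
  have d_nn: "AE x in P. 0 \<le> ?d x"
    using pos by eventually_elim (use sqrt_one_plus_le(1) in force)
  have "(\<integral>x. ?d x \<partial>P) = (\<integral>x. 1 + ?g x / 2 \<partial>P) - (\<integral>x. sqrt (1 + ?g x) \<partial>P)"
    using g_int int by (rule Bochner_Integration.integral_diff)
  also have "(\<integral>x. 1 + ?g x / 2 \<partial>P) = 1"
    by (simp add: m_eq[symmetric] P.prob_space[simplified])
  finally have d_eq: "(\<integral>x. ?d x \<partial>P) = 1 - (\<integral>x. sqrt (1 + ?g x) \<partial>P)" .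
  have "(\<integral>x. ?d x \<partial>P) \<noteq> 0"
  proof
    assume "(\<integral>x. ?d x \<partial>P) = 0"
    then have "AE x in P. ?d x = 0"
      using integral_nonneg_eq_0_iff_AE[OF d_int d_nn] by simp
    then have "AE x in P. x = m"
      using pos by eventually_elim (use sqrt_one_plus_le(2) assms(1) in force)
    with not_AE_const show False by blast
  qed
  with integral_nonneg_AE[OF d_nn] d_eq show "(\<integral>x. sqrt (1 + ?g x) \<partial>P) < 1"
    by simp
qed

text \<open>Taking square roots makes the expectation decay geometrically, whereas the product itself
  has constant expectation 1.\<close>

lemma single_bet_tendsto_zero:
  assumes "\<eta> \<noteq> 0" "\<bar>\<eta>\<bar> \<le> 1"
  shows "AE \<omega> in M. (\<lambda>n. \<Prod>k=1..n. 1 + \<eta> * (X k \<omega> - m)) \<longlonglongrightarrow> 0"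
proof -
  define f where "f x = sqrt (1 + \<eta> * (x - m))" for x
  define r where "r = (\<integral>x. f x \<partial>P)"
  have f_meas [measurable]: "f \<in> borel_measurable borel"
    unfolding f_def by measurable
  have f_nn: "AE x in P. 0 \<le> f x"
    using AE_P by eventually_elim (use factor_pos[OF assms(2)] in \<open>force simp: f_def\<close>)
  have r: "0 \<le> r" "r < 1"
    using sqrt_mean_less_one(1)[OF assms] integral_nonneg_AE[OF f_nn] by (simp_all add: r_def f_def)
  have mean: "(\<integral>\<^sup>+\<omega>. ennreal (f (X k \<omega>)) \<partial>M) = ennreal r" if "1 \<le> k" for k
  proof -
    have "(\<integral>\<^sup>+\<omega>. ennreal (f (X k \<omega>)) \<partial>M) = (\<integral>\<^sup>+x. ennreal (f x) \<partial>P)"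
      unfolding distr_X[OF that, symmetric] using that by (subst nn_integral_distr) auto
    also have "\<dots> = ennreal r"
      unfolding r_def using sqrt_mean_less_one(2)[OF assms] f_nn
      by (intro nn_integral_eq_integral) (simp_all add: f_def)
    finally show ?thesis .
  qed
  define p where "p n \<omega> = (\<Prod>k=1..n. ennreal (f (X k \<omega>)))" for n \<omega>
  have p_meas [measurable]: "p n \<in> borel_measurable M" for n
    unfolding p_def by (intro borel_measurable_prod_ennreal) auto
  have p_mean: "(\<integral>\<^sup>+\<omega>. p n \<omega> \<partial>M) = ennreal (r ^ n)" for n
  proof -
    have "indep_vars (\<lambda>_. borel) (\<lambda>k \<omega>. ennreal (f (X k \<omega>))) {1..n}"
      by (rule indep_vars_compose2[OF indep_vars_subset[OF indep_X]]) auto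
    then have "(\<integral>\<^sup>+\<omega>. p n \<omega> \<partial>M) = (\<Prod>k=1..n. \<integral>\<^sup>+\<omega>. ennreal (f (X k \<omega>)) \<partial>M)"
      unfolding p_def by (intro indep_vars_nn_integral) auto
    also have "\<dots> = (\<Prod>k=1..n. ennreal r)"
      by (intro prod.cong mean) auto
    finally show ?thesis
      using r by (simp add: ennreal_power)
  qed
  have "(\<integral>\<^sup>+\<omega>. (\<Sum>n. p n \<omega>) \<partial>M) = (\<Sum>n. ennreal (r ^ n))"
    by (simp add: nn_integral_suminf p_mean)
  also have "\<dots> = ennreal (\<Sum>n. r ^ n)"
    using r by (intro suminf_ennreal2 summable_geometric) auto
  finally have "(\<integral>\<^sup>+\<omega>. (\<Sum>n. p n \<omega>) \<partial>M) \<noteq> \<infinity>"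
    by simp
  then have "AE \<omega> in M. (\<Sum>n. p n \<omega>) \<noteq> \<infinity>"
    by (intro nn_integral_PInf_AE) auto
  with AE_X show ?thesis
  proof eventually_elim
    case (elim \<omega>)
    have pos: "0 \<le> 1 + \<eta> * (X k \<omega> - m)" if "1 \<le> k" for k
      using factor_pos[OF assms(2), of "X k \<omega>"] elim(1) that by force
    define q where "q n = (\<Prod>k=1..n. 1 + \<eta> * (X k \<omega> - m))" for n
    have q_nn: "0 \<le> q n" for n
      unfolding q_def by (intro prod_nonneg pos) auto
    have "p n \<omega> = ennreal (sqrt (q n))" for n
    proof -
      have "p n \<omega> = ennreal (\<Prod>k=1..n. f (X k \<omega>))"
        unfolding p_def by (intro prod_ennreal) (auto simp: f_def intro!: pos)
      moreover have "(\<Prod>k=1..n. f (X k \<omega>)) = sqrt (q n)"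
        by (induction n) (simp_all add: f_def q_def real_sqrt_mult)
      ultimately show ?thesis
        by simp
    qed
    with elim(2) have "(\<Sum>n. ennreal (sqrt (q n))) \<noteq> top"
      by simp
    then have "summable (\<lambda>n. sqrt (q n))"
      using q_nn by (intro summable_suminf_not_top) auto
    then have "(\<lambda>n. (sqrt (q n))\<^sup>2) \<longlonglongrightarrow> 0\<^sup>2"
      by (intro tendsto_power summable_LIMSEQ_zero)
    then have "q \<longlonglongrightarrow> 0"
      using q_nn by simp
    then show ?case
      unfolding q_def[abs_def] .
  qed
qed

lemma wealth_on_away_tendsto_zero:
  assumes "0 < \<eta>" "\<eta> \<le> 1"
  shows "AE \<omega> in M. (\<lambda>n. wealth_on {l. \<eta> \<le> \<bar>l\<bar>} n \<omega>) \<longlonglongrightarrow> 0"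
proof -
  have "AE \<omega> in M. (\<lambda>n. \<Prod>k=1..n. 1 + \<eta> * (X k \<omega> - m)) \<longlonglongrightarrow> 0"
    "AE \<omega> in M. (\<lambda>n. \<Prod>k=1..n. 1 + (- \<eta>) * (X k \<omega> - m)) \<longlonglongrightarrow> 0"
    by (rule single_bet_tendsto_zero; use assms in simp)+
  with AE_X show ?thesis
  proof eventually_elim
    case (elim \<omega>)
    define q where "q l n = (\<Prod>k=1..n. 1 + l * (X k \<omega> - m))" for l n
    define b where "b n = max (q \<eta> n) (q (- \<eta>) n)" for n
    have lim: "q \<eta> \<longlonglongrightarrow> 0" "q (- \<eta>) \<longlonglongrightarrow> 0"
      using elim(2,3) unfolding q_def[abs_def] .
    then have "b \<longlonglongrightarrow> max 0 0"
      unfolding b_def[abs_def] by (intro tendsto_max)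
    then have b_lim: "(\<lambda>n. ennreal (b n)) \<longlonglongrightarrow> 0"
      using tendsto_ennrealI[of b 0] by simp
    have le: "q l n \<le> b n"
      if l: "l \<in> {- 1 / (1 - m)..1 / m}" "\<eta> \<le> \<bar>l\<bar>" and q1: "q \<eta> n \<le> 1" "q (- \<eta>) n \<le> 1" for l n
    proof -
      have scaled: "q l n \<le> q (\<sigma> * \<eta>) n" if \<sigma>: "\<sigma> \<in> {1, -1}" "l = \<sigma> * \<bar>l\<bar>" for \<sigma>
      proof -
        have *: "(\<bar>l\<bar> / \<eta>) * (\<sigma> * \<eta> * y) = l * y" for y
          using assms(1) \<sigma> by auto
        have "(\<Prod>k=1..n. 1 + (\<bar>l\<bar> / \<eta>) * (\<sigma> * \<eta> * (X k \<omega> - m))) \<le> (\<Prod>k=1..n. 1 + \<sigma> * \<eta> * (X k \<omega> - m))"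
        proof (rule prod_scaled_le)
          show "1 \<le> \<bar>l\<bar> / \<eta>"
            using l(2) assms(1) by simp
          show "- 1 < \<sigma> * \<eta> * (X k \<omega> - m)" if "k \<in> {1..n}" for k
            using factor_pos[of "\<sigma> * \<eta>" "X k \<omega>"] assms elim(1) \<sigma>(1) that by auto
          show "0 \<le> 1 + (\<bar>l\<bar> / \<eta>) * (\<sigma> * \<eta> * (X k \<omega> - m))" if "k \<in> {1..n}" for k
            unfolding * using factor_nonneg[OF l(1)] elim(1) that by auto
          show "(\<Prod>k=1..n. 1 + \<sigma> * \<eta> * (X k \<omega> - m)) \<le> 1"
            using q1 \<sigma>(1) unfolding q_def by auto
        qed
        then show ?thesis
          unfolding * q_def .
      qed
      show ?thesis
        using scaled[of 1] scaled[of "-1"] by (cases "0 \<le> l") (auto simp: b_def)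
    qed
    have "\<forall>\<^sub>F n in sequentially. q \<eta> n < 1 \<and> q (- \<eta>) n < 1"
      using lim by (intro eventually_conj order_tendstoD(2)[where a = 1]) auto
    then have "\<forall>\<^sub>F n in sequentially. wealth_on {l. \<eta> \<le> \<bar>l\<bar>} n \<omega> \<le> ennreal (b n)"
    proof eventually_elim
      case (elim n)
      have bet_prod: "(\<Prod>k=1..n. bet l (X k \<omega>)) = ennreal (q l n)" if "l \<in> {- 1 / (1 - m)..1 / m}" for l
        unfolding bet_def q_def using factor_nonneg[OF that] \<open>\<forall>k\<ge>1. X k \<omega> \<in> {0..1}\<close>
        by (intro prod_ennreal) auto
      have "wealth_on {l. \<eta> \<le> \<bar>l\<bar>} n \<omega> \<le> (\<integral>\<^sup>+l. ennreal (b n) \<partial>\<pi>)"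
        unfolding wealth_on_def
      proof (rule nn_integral_mono_AE)
        show "AE l in \<pi>. indicator {l. \<eta> \<le> \<bar>l\<bar>} l * (\<Prod>k=1..n. bet l (X k \<omega>)) \<le> ennreal (b n)"
          using AE_\<pi>
        proof eventually_elim
          case l: (elim l)
          show ?case
            unfolding bet_prod[OF l] using le[OF l, of n] elim
            by (auto split: split_indicator intro!: ennreal_leI)
        qed
      qed
      then show ?case
        by (simp add: \<pi>.emeasure_space_1[simplified])
    qed
    then show ?case
      by (intro tendsto_sandwich[OF _ _ tendsto_const b_lim]) auto
  qed
qed

lemma wealth_on_near_small:
  assumes "0 < \<epsilon>" "\<epsilon> < top"
  shows "AE \<omega> in M. \<exists>j. \<forall>n. wealth_on {l. 0 < \<bar>l\<bar> \<and> \<bar>l\<bar> < 1 / real (Suc j)} n \<omega> \<le> \<epsilon>"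
proof -
  let ?D = "\<lambda>j. {l :: real. 0 < \<bar>l\<bar> \<and> \<bar>l\<bar> < 1 / real (Suc j)}"
  let ?B = "\<lambda>j. {\<omega>\<in>space M. \<exists>n. \<epsilon> < wealth_on (?D j) n \<omega>}"
  have D: "?D j \<in> sets borel" for j
    by measurable
  have B: "?B j \<in> sets M" for j
  proof -
    have "{\<omega>\<in>space M. \<exists>n. \<epsilon> < wealth_on A n \<omega>} \<in> sets M" if "A \<in> sets borel" for A
    proof -
      note [measurable] = wealth_on_ville(2)[OF that]
      show ?thesis
        by measurable
    qed
    then show ?thesis
      using D by blast
  qed
  have "(\<lambda>j. emeasure \<pi> (?D j)) \<longlonglongrightarrow> emeasure \<pi> (\<Inter>j. ?D j)"
  proof (rule Lim_emeasure_decseq)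
    show "range ?D \<subseteq> sets \<pi>"
      using D by auto
    show "decseq ?D"
      by (auto simp: decseq_def elim!: order.strict_trans2 intro!: frac_le)
  qed (simp add: \<pi>.emeasure_finite)
  moreover have "(\<Inter>j. ?D j) = {}"
  proof -
    have False if l: "\<forall>j. l \<in> ?D j" for l
    proof -
      obtain j where "1 / real (Suc j) < \<bar>l\<bar>"
        using l reals_Archimedean[of "\<bar>l\<bar>"] unfolding inverse_eq_divide by blast
      then show False
        using l[rule_format, of j] by simp
    qed
    then show ?thesis
      by blast
  qed
  ultimately have "(\<lambda>j. emeasure \<pi> (?D j)) \<longlonglongrightarrow> 0"
    by simp
  moreover have "\<epsilon> * emeasure M (\<Inter>j. ?B j) \<le> emeasure \<pi> (?D j)" for j
  proof (rule order_trans[OF mult_left_mono wealth_on_ville(1)[OF D]])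
    show "emeasure M (\<Inter>j. ?B j) \<le> emeasure M (?B j)"
      by (intro emeasure_mono B INF_lower) simp
  qed simp
  ultimately have "\<epsilon> * emeasure M (\<Inter>j. ?B j) \<le> 0"
    by (intro LIMSEQ_le_const) auto
  then have null: "emeasure M (\<Inter>j. ?B j) = 0"
    using assms by auto
  show ?thesis
  proof (rule AE_I[OF _ null])
    show "(\<Inter>j. ?B j) \<in> sets M"
      using B by (intro sets.countable_INT) auto
  qed (auto simp: not_le)
qed

lemma wealth_on_nonzero_tendsto_zero: "AE \<omega> in M. (\<lambda>n. wealth_on (- {0}) n \<omega>) \<longlonglongrightarrow> 0"
proof -
  let ?D = "\<lambda>j. {l :: real. 0 < \<bar>l\<bar> \<and> \<bar>l\<bar> < 1 / real (Suc j)}"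
  let ?E = "\<lambda>j. {l :: real. 1 / real (Suc j) \<le> \<bar>l\<bar>}"
  have "AE \<omega> in M. \<forall>i. \<exists>j. \<forall>n. wealth_on (?D j) n \<omega> \<le> ennreal (1 / real (Suc i))"
    unfolding AE_all_countable by (intro allI wealth_on_near_small) (auto simp: ennreal_less_top)
  moreover have "AE \<omega> in M. \<forall>j. (\<lambda>n. wealth_on (?E j) n \<omega>) \<longlonglongrightarrow> 0"
    unfolding AE_all_countable by (intro allI wealth_on_away_tendsto_zero) auto
  ultimately show ?thesis
  proof eventually_elim
    case (elim \<omega>)
    have split: "wealth_on (- {0}) n \<omega> = wealth_on (?D j) n \<omega> + wealth_on (?E j) n \<omega>" for n j
    proof -
      have [measurable]: "(\<lambda>l. \<Prod>k=1..n. bet l (X k \<omega>)) \<in> borel_measurable \<pi>"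
        by (intro borel_measurable_prod_ennreal) simp
      have D: "(indicator (?D j) :: real \<Rightarrow> ennreal) \<in> borel_measurable \<pi>"
        and E: "(indicator (?E j) :: real \<Rightarrow> ennreal) \<in> borel_measurable \<pi>"
        by (simp_all add: borel_measurable_indicator_iff)
      have "0 < 1 / real (Suc j)"
        by simp
      then have "indicator (- {0}) l = (indicator (?D j) l + indicator (?E j) l :: ennreal)" for l :: real
        by (auto split: split_indicator simp del: of_nat_Suc)
      then show ?thesis
        unfolding wealth_on_def using D E by (simp add: distrib_right nn_integral_add del: of_nat_Suc)
    qed
    show ?case
    proof (rule order_tendstoI)
      fix a :: ennreal assume "0 < a"
      then obtain r where r: "0 < ennreal r" "ennreal r < a"
        using dense[of 0 a] by (metis ennreal_cases less_top_ennreal not_less_iff_gr_or_eq order_less_trans top_greatest leD)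
      then have "0 < r / 2"
        by simp
      then obtain i where i: "1 / real (Suc i) < r / 2"
        using reals_Archimedean[of "r / 2"] by (auto simp: inverse_eq_divide)
      obtain j where j: "\<And>n. wealth_on (?D j) n \<omega> \<le> ennreal (1 / real (Suc i))"
        using elim(1) by blast
      have "\<forall>\<^sub>F n in sequentially. wealth_on (?E j) n \<omega> < ennreal (r / 2)"
        using elim(2) \<open>0 < r / 2\<close> by (intro order_tendstoD(2)[where y = 0]) auto
      then show "\<forall>\<^sub>F n in sequentially. wealth_on (- {0}) n \<omega> < a"
      proof eventually_elim
        case (elim n)
        have "wealth_on (?D j) n \<omega> \<le> ennreal (r / 2)"
          using order_trans[OF j[of n] ennreal_leI[OF less_imp_le[OF i]]] .
        then have "wealth_on (- {0}) n \<omega> \<le> ennreal (r / 2) + ennreal (r / 2)"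
          unfolding split[of n j] using elim by (intro add_mono) auto
        also have "\<dots> = ennreal r"
          using \<open>0 < r / 2\<close> by (subst ennreal_plus[symmetric]) auto
        finally show ?case
          using r(2) by simp
      qed
    qed simp
  qed
qed

lemma mixture_wealth_eq:
  assumes "\<forall>k\<ge>1. X k \<omega> \<in> {0..1}"
  shows "mixture_wealth \<pi> m X n \<omega> = enn2real (emeasure \<pi> {0} + wealth_on (- {0}) n \<omega>)"
proof -
  have [measurable]: "(\<lambda>l. \<Prod>k=1..n. bet l (X k \<omega>)) \<in> borel_measurable \<pi>"
    by (intro borel_measurable_prod_ennreal) simp
  have nn: "AE l in \<pi>. \<forall>k\<in>{1..n}. 0 \<le> 1 + l * (X k \<omega> - m)"
    using AE_\<pi> by eventually_elim (use factor_nonneg assms in auto)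
  have "mixture_wealth \<pi> m X n \<omega> = enn2real (\<integral>\<^sup>+l. ennreal (\<Prod>k=1..n. 1 + l * (X k \<omega> - m)) \<partial>\<pi>)"
    unfolding mixture_wealth_def
  proof (rule integral_eq_nn_integral)
    show "AE l in \<pi>. 0 \<le> (\<Prod>k=1..n. 1 + l * (X k \<omega> - m))"
      using nn by eventually_elim (auto intro: prod_nonneg)
  qed simp
  also have "(\<integral>\<^sup>+l. ennreal (\<Prod>k=1..n. 1 + l * (X k \<omega> - m)) \<partial>\<pi>) = (\<integral>\<^sup>+l. (\<Prod>k=1..n. bet l (X k \<omega>)) \<partial>\<pi>)"
  proof (rule nn_integral_cong_AE)
    show "AE l in \<pi>. ennreal (\<Prod>k=1..n. 1 + l * (X k \<omega> - m)) = (\<Prod>k=1..n. bet l (X k \<omega>))"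
      using nn by eventually_elim (unfold bet_def, rule prod_ennreal[symmetric], blast)
  qed
  also have "\<dots> = (\<integral>\<^sup>+l. indicator {0} l + indicator (- {0}) l * (\<Prod>k=1..n. bet l (X k \<omega>)) \<partial>\<pi>)"
    by (intro nn_integral_cong) (auto simp: bet_def split: split_indicator)
  also have "\<dots> = emeasure \<pi> {0} + wealth_on (- {0}) n \<omega>"
    unfolding wealth_on_def by (subst nn_integral_add) auto
  finally show ?thesis .
qed

lemma mixture_wealth_tendsto:
  "AE \<omega> in M. (\<lambda>n. mixture_wealth \<pi> m X n \<omega>) \<longlonglongrightarrow> measure \<pi> {0}"
  using AE_X wealth_on_nonzero_tendsto_zero
proof eventually_elim
  case (elim \<omega>)
  have "(\<lambda>n. emeasure \<pi> {0} + wealth_on (- {0}) n \<omega>) \<longlonglongrightarrow> emeasure \<pi> {0} + 0"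
    using elim(2) by (intro tendsto_add tendsto_const)
  then have "(\<lambda>n. enn2real (emeasure \<pi> {0} + wealth_on (- {0}) n \<omega>)) \<longlonglongrightarrow> measure \<pi> {0}"
    by (intro tendsto_enn2real) (simp_all add: \<pi>.emeasure_eq_measure)
  then show ?case
    by (simp add: mixture_wealth_eq[OF elim(1)])
qed

end

theorem theorem3p1:
  fixes M :: "'a measure"
    and P \<pi> :: "real measure"
    and X :: "nat \<Rightarrow> 'a \<Rightarrow> real"
    and m :: real
  assumes "distribution_on {0..1} P"
    and "\<not> point_mass P"
    and "m = (\<integral>x. x \<partial>P)"
    and "prob_space M"
    and "prob_space.indep_vars M (\<lambda>_. borel) X {1..}"
    and "\<And>k. k \<ge> 1 \<Longrightarrow> distr M borel (X k) = P"
    and "distribution_on {- 1 / (1 - m)..1 / m} \<pi>"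
  shows "(AE \<omega> in M. (\<lambda>n. mixture_wealth \<pi> m X n \<omega>) \<longlonglongrightarrow> measure \<pi> {0}) \<and>
    ((AE \<omega> in M. (\<lambda>n. mixture_wealth \<pi> m X n \<omega>) \<longlonglongrightarrow> 0) \<longleftrightarrow> measure \<pi> {0} = 0)"
proof -
  interpret prob_space M by fact
  interpret iid_wealth M P \<pi> X m
    by unfold_locales (use assms in auto)
  note lim = mixture_wealth_tendsto
  have "measure \<pi> {0} = 0" if "AE \<omega> in M. (\<lambda>n. mixture_wealth \<pi> m X n \<omega>) \<longlonglongrightarrow> 0"
  proof -
    have "AE \<omega> in M. measure \<pi> {0} = 0"
      using lim that by eventually_elim (rule LIMSEQ_unique)
    then show ?thesis
      by simp
  qed
  with lim show ?thesis
    by auto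
qed

end
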